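(* For $j=1,2$ let $\|\cdot\|_j$ be any norm on $C^1([0,1])$ (not assumed to be complete). Suppose that $\operatorname{Iso}((C^{1}([0,1]),\|\cdot\|_1), (C^{1}([0,1]),\|\cdot\|_{2}))$ is equal to the set of all maps $S:C^{1}([0,1])\to C^{1}([0,1])$ for which there exist $\beta \in C^{1}([0,1])$, $\alpha \in \mathbb{T}$, $\pi\in\{\operatorname{Id},\,1-\operatorname{Id}\}$ and $\epsilon\in\{1,-1\}$ such that $S(f)=\beta + \alpha [f\circ \pi]^\epsilon$ for every $f \in C^{1}([0,1])$. Suppose that a map $T:C^{1}([0,1])\to C^{1}([0,1])$ is 2-local in $\operatorname{Iso}((C^{1}([0,1]),\|\cdot\|_1), (C^{1}([0,1]),\|\cdot\|_{2}))$. Then $T \in \operatorname{Iso}((C^{1}([0,1]),\|\cdot\|_1), (C^{1}([0,1]),\|\cdot\|_{2}))$.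
   Context: $C^1([0,1])$ is the algebra of all complex-valued continuously differentiable functions on $[0,1]$. $\operatorname{Id}$ is the identity map of $[0,1]$, so $1-\operatorname{Id}$ is $t\mapsto 1-t$. $\mathbb{T}=\{z\in\mathbb{C}:|z|=1\}$. For a complex-valued function $f$, $[f]^{1}=f$ and $[f]^{-1}=\overline{f}$ (complex conjugate). For normed spaces $\mathfrak{M}_1,\mathfrak{M}_2$, $\operatorname{Iso}(\mathfrak{M}_1,\mathfrak{M}_2)$ is the set of all surjective isometries (distance preserving maps, not necessarily linear) from $\mathfrak{M}_1$ onto $\mathfrak{M}_2$. A map $T:\mathfrak{M}_1\to\mathfrak{M}_2$ (no linearity, continuity or surjectivity assumed) is 2-local in $\operatorname{Iso}(\mathfrak{M}_1,\mathfrak{M}_2)$ if for every $x,y\in\mathfrak{M}_1$ there is $T_{x,y}\in\operatorname{Iso}(\mathfrak{M}_1,\mathfrak{M}_2)$ such that $T(x)=T_{x,y}(x)$ and $T(y)=T_{x,y}(y)$. *)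

theory Defs
  imports "HOL-Analysis.Analysis"
begin

text \<open>
  An element of C1([0,1]) is represented by its extension by zero to the real line, so that two
  elements are equal iff they agree on [0,1]. Because of this extension the derivative has to be
  taken within [0,1] (one-sided at the end points); the library's \<open>C1_differentiable_on\<close>
  uses the two-sided filter \<open>at t\<close> and would exclude functions not vanishing at 0 or 1.
\<close>

typedef c1 = "{f :: real \<Rightarrow> complex.
    (\<exists>D. continuous_on {0..1} D \<and>
         (\<forall>t\<in>{0..1}. (f has_vector_derivative D t) (at t within {0..1}))) \<and>
    (\<forall>t. t \<notin> {0..1} \<longrightarrow> f t = 0)}"
  morphisms c1_fun Abs_c1
  by (rule exI[of _ "\<lambda>_. 0"]) (auto intro!: exI[of _ "\<lambda>_. 0"])

setup_lifting type_definition_c1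

lemma c1_eqI: "(\<And>t. t \<in> {0..1} \<Longrightarrow> c1_fun f t = c1_fun g t) \<Longrightarrow> f = g"
  by transfer (auto simp: fun_eq_iff, metis)

instantiation c1 :: ab_group_add
begin

lift_definition zero_c1 :: c1 is "\<lambda>_. 0"
  by (auto intro!: exI[of _ "\<lambda>_. 0"])

lift_definition plus_c1 :: "c1 \<Rightarrow> c1 \<Rightarrow> c1" is "\<lambda>f g t. f t + g t"
proof (safe, goal_cases)
  case (1 f g D E)
  then show ?case
    by (intro exI[of _ "\<lambda>t. D t + E t"])
       (auto intro!: continuous_intros derivative_intros)
qed auto

lift_definition uminus_c1 :: "c1 \<Rightarrow> c1" is "\<lambda>f t. - f t"
proof (safe, goal_cases)
  case (1 f D)
  then show ?case
    by (intro exI[of _ "\<lambda>t. - D t"])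
       (auto intro!: continuous_intros derivative_intros)
qed auto

lift_definition minus_c1 :: "c1 \<Rightarrow> c1 \<Rightarrow> c1" is "\<lambda>f g t. f t - g t"
proof (safe, goal_cases)
  case (1 f g D E)
  then show ?case
    by (intro exI[of _ "\<lambda>t. D t - E t"])
       (auto intro!: continuous_intros derivative_intros)
qed auto

instance
  by standard (transfer; simp add: fun_eq_iff)+

end

lift_definition c1_scale :: "complex \<Rightarrow> c1 \<Rightarrow> c1" is "\<lambda>c f t. c * f t"
proof (safe, goal_cases)
  case (1 c f D)
  then show ?case
    by (intro exI[of _ "\<lambda>t. c * D t"])
       (auto intro!: continuous_intros has_vector_derivative_mult_right)
qed auto

lemma vector_space_c1: "vector_space c1_scale"
  by unfold_locales (transfer; simp add: fun_eq_iff algebra_simps)+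

definition is_c1_norm :: "(c1 \<Rightarrow> real) \<Rightarrow> bool" where
  "is_c1_norm N \<longleftrightarrow>
     (\<forall>f. 0 \<le> N f) \<and>
     (\<forall>f. N f = 0 \<longleftrightarrow> f = 0) \<and>
     (\<forall>c f. N (c1_scale c f) = cmod c * N f) \<and>
     (\<forall>f g. N (f + g) \<le> N f + N g)"

definition Iso :: "('a::ab_group_add \<Rightarrow> real) \<Rightarrow> ('b::ab_group_add \<Rightarrow> real) \<Rightarrow> ('a \<Rightarrow> 'b) set" where
  "Iso N1 N2 = {S. surj S \<and> (\<forall>x y. N2 (S x - S y) = N1 (x - y))}"

definition two_local :: "('a \<Rightarrow> 'b) set \<Rightarrow> ('a \<Rightarrow> 'b) \<Rightarrow> bool" where
  "two_local F T \<longleftrightarrow> (\<forall>x y. \<exists>S\<in>F. T x = S x \<and> T y = S y)"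

text \<open>The notation $[f]^{\epsilon}$; only the exponents 1 and -1 are meaningful.\<close>

definition conj_pow :: "(real \<Rightarrow> complex) \<Rightarrow> int \<Rightarrow> real \<Rightarrow> complex" where
  "conj_pow f \<epsilon> = (if \<epsilon> = -1 then cnj \<circ> f else f)"

end

theory Submission
  imports Defs
begin

text \<open>
  Subtracting \<open>T 0\<close> gives a map \<open>V\<close> such that \<open>V f - V g\<close> always lies in the orbit of \<open>f - g\<close>
  under rotations, conjugation and the reflection \<open>t \<mapsto> 1 - t\<close>. Hence, for each \<open>t\<close>, it preserves
  the quadratic form \<open>\<bar>f t\<bar>\<^sup>2 + \<bar>f (1 - t)\<bar>\<^sup>2\<close> of differences and so, by polarization, the real bilinear
  form \<open>f t \<bullet> g t + f (1 - t) \<bullet> g (1 - t)\<close>. After composing with a group element, \<open>V\<close>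
  fixes \<open>1\<close>, \<open>\<i>\<close> and \<open>Id\<close>, and then also \<open>\<i> Id\<close>. Testing the form against these four
  functions recovers \<open>f t\<close> from \<open>V f\<close>.
\<close>

text \<open>The source of the test functions: \<open>c1_affine 1 0\<close>,
  \<open>c1_affine \<i> 0\<close>, \<open>c1_affine 0 1\<close> and \<open>c1_affine 0 \<i>\<close>
  are 1, \<i>, \<open>Id\<close> and \<i> \<open>Id\<close>. The value 0 off [0,1] is forced by the
  representation by zero extension.\<close>

lift_definition c1_affine :: "complex \<Rightarrow> complex \<Rightarrow> c1" is
  "\<lambda>a b t. if t \<in> {0..1} then a + b * of_real t else 0"
proof (intro conjI, goal_cases)
  case (1 a b)
  have "((\<lambda>t. if t \<in> {0..1} then a + b * of_real t else 0) has_vector_derivative b)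
          (at t within {0..1})" if "t \<in> {0..1}" for t
  proof -
    have "((\<lambda>t. a + b * of_real t) has_vector_derivative (0 + b * of_real 1)) (at t within {0..1})"
      by (intro has_vector_derivative_add has_vector_derivative_mult_right
          has_vector_derivative_of_real has_vector_derivative_const DERIV_ident)
    then show ?thesis
      using that by (auto intro: has_vector_derivative_transform[rotated 2])
  qed
  then show ?case
    by (intro exI[of _ "\<lambda>_. b"]) auto
qed auto

lemma c1_fun_affine: "t \<in> {0..1} \<Longrightarrow> c1_fun (c1_affine a b) t = a + b * of_real t"
  by transfer simp

section \<open>Orbits under rotation, conjugation and reflection\<close>

text \<open>Stated for raw functions and only on [0,1], so that rotated, reflected or conjugated
  images need not be rebuilt as elements of \<open>c1\<close>.\<close>

definition in_orbit :: "(real \<Rightarrow> complex) \<Rightarrow> (real \<Rightarrow> complex) \<Rightarrow> bool" where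
  "in_orbit k h \<longleftrightarrow> (\<exists>\<alpha> \<pi> \<epsilon>. cmod \<alpha> = 1 \<and> \<pi> \<in> {\<lambda>t. t, \<lambda>t. 1 - t} \<and> \<epsilon> \<in> {1, -1} \<and>
     (\<forall>t\<in>{0..1}. h t = \<alpha> * conj_pow (k \<circ> \<pi>) \<epsilon> t))"

lemma in_orbit_alt:
  "in_orbit k h \<longleftrightarrow> (\<exists>\<alpha>. cmod \<alpha> = 1 \<and>
     ((\<forall>t\<in>{0..1}. h t = \<alpha> * k t) \<or> (\<forall>t\<in>{0..1}. h t = \<alpha> * k (1 - t)) \<or>
      (\<forall>t\<in>{0..1}. h t = \<alpha> * cnj (k t)) \<or> (\<forall>t\<in>{0..1}. h t = \<alpha> * cnj (k (1 - t)))))"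
proof -
  have "(\<exists>\<pi> \<epsilon>. \<pi> \<in> {\<lambda>t. t, \<lambda>t. 1 - t} \<and> \<epsilon> \<in> {1, -1} \<and> P \<pi> \<epsilon>) \<longleftrightarrow>
      P (\<lambda>t. t) 1 \<or> P (\<lambda>t. 1 - t) 1 \<or> P (\<lambda>t. t) (- 1) \<or> P (\<lambda>t. 1 - t) (- 1)"
    for P :: "(real \<Rightarrow> real) \<Rightarrow> int \<Rightarrow> bool"
    by blast
  then show ?thesis
    unfolding in_orbit_def by (simp add: conj_pow_def)
qed

lemma in_orbit_scale: "in_orbit k h \<Longrightarrow> cmod a = 1 \<Longrightarrow> in_orbit k (\<lambda>t. a * h t)"
  unfolding in_orbit_def by (elim exE, rule_tac x = "a * \<alpha>" in exI) (auto simp: norm_mult mult.assoc)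

lemma in_orbit_reflect: "in_orbit k h \<Longrightarrow> in_orbit k (\<lambda>t. h (1 - t))"
proof -
  assume "in_orbit k h"
  then obtain \<alpha> where "cmod \<alpha> = 1" and
    "(\<forall>t\<in>{0..1}. h t = \<alpha> * k t) \<or> (\<forall>t\<in>{0..1}. h t = \<alpha> * k (1 - t)) \<or>
      (\<forall>t\<in>{0..1}. h t = \<alpha> * cnj (k t)) \<or> (\<forall>t\<in>{0..1}. h t = \<alpha> * cnj (k (1 - t)))"
    unfolding in_orbit_alt by blast
  then show ?thesis
    unfolding in_orbit_alt by (intro exI[of _ \<alpha>]) (elim disjE; simp)
qed

lemma in_orbit_cnj: "in_orbit k h \<Longrightarrow> in_orbit k (\<lambda>t. cnj (h t))"
proof -
  assume "in_orbit k h"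
  then obtain \<alpha> where "cmod \<alpha> = 1" and
    "(\<forall>t\<in>{0..1}. h t = \<alpha> * k t) \<or> (\<forall>t\<in>{0..1}. h t = \<alpha> * k (1 - t)) \<or>
      (\<forall>t\<in>{0..1}. h t = \<alpha> * cnj (k t)) \<or> (\<forall>t\<in>{0..1}. h t = \<alpha> * cnj (k (1 - t)))"
    unfolding in_orbit_alt by blast
  then show ?thesis
    unfolding in_orbit_alt by (intro exI[of _ "cnj \<alpha>"]) (elim disjE; simp)
qed

text \<open>The modulus removes \<alpha> and the conjugation; summing over t and 1 - t removes the
  reflection.\<close>

lemma in_orbit_norm:
  assumes "in_orbit k h" and "t \<in> {0..1}"
  shows "(cmod (h t))\<^sup>2 + (cmod (h (1 - t)))\<^sup>2 = (cmod (k t))\<^sup>2 + (cmod (k (1 - t)))\<^sup>2"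
  using assms unfolding in_orbit_alt by (elim exE conjE disjE) (simp_all add: norm_mult)

text \<open>Sees what the quadratic form misses: the form takes equal values on t - \<i> t and t -
  \<i> (1 - t), but only the first vanishes at an end point.\<close>

lemma in_orbit_zero: "in_orbit k h \<Longrightarrow> k 0 = 0 \<Longrightarrow> h 0 = 0 \<or> h 1 = 0"
  unfolding in_orbit_alt by (elim exE conjE disjE) simp_all

section \<open>Maps whose differences stay in orbits\<close>

definition orbit_map :: "(c1 \<Rightarrow> real \<Rightarrow> complex) \<Rightarrow> bool" where
  "orbit_map V \<longleftrightarrow> (\<forall>t. V 0 t = 0) \<and>
     (\<forall>f g. in_orbit (\<lambda>t. c1_fun f t - c1_fun g t) (\<lambda>t. V f t - V g t))"

lemma orbit_map_in_orbit: "orbit_map V \<Longrightarrow> in_orbit (c1_fun f) (V f)"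
proof -
  assume "orbit_map V"
  then have "\<And>t. V 0 t = 0" "in_orbit (\<lambda>t. c1_fun f t - c1_fun 0 t) (\<lambda>t. V f t - V 0 t)"
    unfolding orbit_map_def by blast+
  then show ?thesis
    by (simp add: zero_c1.rep_eq)
qed

text \<open>This and the next two lemmas allow a map to be normalised by group elements without
  leaving the class.\<close>

lemma orbit_map_scale: "orbit_map V \<Longrightarrow> cmod a = 1 \<Longrightarrow> orbit_map (\<lambda>f t. a * V f t)"
  unfolding orbit_map_def by (auto simp: right_diff_distrib[symmetric] intro: in_orbit_scale)

lemma orbit_map_reflect: "orbit_map V \<Longrightarrow> orbit_map (\<lambda>f t. V f (1 - t))"
  unfolding orbit_map_def by (auto dest: in_orbit_reflect)

lemma orbit_map_cnj: "orbit_map V \<Longrightarrow> orbit_map (\<lambda>f t. cnj (V f t))"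
  unfolding orbit_map_def
  by (auto simp: complex_cnj_diff[symmetric] simp del: complex_cnj_diff intro: in_orbit_cnj)

text \<open>Invariance of the form at \<open>f - g\<close>, \<open>f\<close> and \<open>g\<close>
  leaves only the cross terms.\<close>

lemma orbit_map_inner:
  assumes "orbit_map V" and t: "t \<in> {0..1}"
  shows "V f t \<bullet> V g t + V f (1 - t) \<bullet> V g (1 - t)
       = c1_fun f t \<bullet> c1_fun g t + c1_fun f (1 - t) \<bullet> c1_fun g (1 - t)"
proof -
  have "in_orbit (\<lambda>t. c1_fun f t - c1_fun g t) (\<lambda>t. V f t - V g t)"
    using assms(1) by (simp add: orbit_map_def)
  note in_orbit_norm[OF this t] in_orbit_norm[OF orbit_map_in_orbit[OF assms(1), of f] t]
    in_orbit_norm[OF orbit_map_in_orbit[OF assms(1), of g] t]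
  then show ?thesis
    by (simp add: power2_norm_eq_inner inner_diff_left inner_diff_right inner_commute)
qed

text \<open>Reflection does not move constants, and rotation and conjugation keep them
  constant.\<close>

lemma orbit_map_const:
  assumes "orbit_map V"
  obtains \<alpha> where "cmod \<alpha> = cmod a" and "\<And>t. t \<in> {0..1} \<Longrightarrow> V (c1_affine a 0) t = \<alpha>"
proof -
  obtain \<alpha> where "cmod \<alpha> = 1" and
    "(\<forall>t\<in>{0..1}. V (c1_affine a 0) t = \<alpha> * a) \<or> (\<forall>t\<in>{0..1}. V (c1_affine a 0) t = \<alpha> * cnj a)"
    using orbit_map_in_orbit[OF assms, of "c1_affine a 0"] unfolding in_orbit_alt
    by (auto simp: c1_fun_affine)
  then show ?thesis
    using that[of "\<alpha> * a"] that[of "\<alpha> * cnj a"] by (auto simp: norm_mult)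
qed

section \<open>Maps fixing 1 and \<i>\<close>

context
  fixes V
  assumes V: "orbit_map V"
    and V1: "\<And>t. t \<in> {0..1} \<Longrightarrow> V (c1_affine 1 0) t = 1"
    and Vi: "\<And>t. t \<in> {0..1} \<Longrightarrow> V (c1_affine \<i> 0) t = \<i>"
begin

text \<open>Pairing with 1 reads off real parts, pairing with \<i> imaginary parts.\<close>

lemma sum_reflect_preserved:
  assumes t: "t \<in> {0..1}"
  shows "V f t + V f (1 - t) = c1_fun f t + c1_fun f (1 - t)"
proof (rule complex_eqI)
  show "Re (V f t + V f (1 - t)) = Re (c1_fun f t + c1_fun f (1 - t))"
    using orbit_map_inner[OF V t, of f "c1_affine 1 0"] t V1[of t] V1[of "1 - t"]
    by (simp add: c1_fun_affine inner_complex_def)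
  show "Im (V f t + V f (1 - t)) = Im (c1_fun f t + c1_fun f (1 - t))"
    using orbit_map_inner[OF V t, of f "c1_affine \<i> 0"] t Vi[of t] Vi[of "1 - t"]
    by (simp add: c1_fun_affine inner_complex_def)
qed

lemma linear_image:
  assumes "a \<in> {1, \<i>}"
  shows "(\<forall>t\<in>{0..1}. V (c1_affine 0 a) t = a * of_real t) \<or>
         (\<forall>t\<in>{0..1}. V (c1_affine 0 a) t = a * (1 - of_real t))"
proof -
  \<comment> \<open>As t is real, conjugation affects only the scalar factor, so four cases become
    two.\<close>
  obtain \<alpha> where \<alpha>: "(\<forall>t\<in>{0..1}. V (c1_affine 0 a) t = \<alpha> * of_real t) \<or>
      (\<forall>t\<in>{0..1}. V (c1_affine 0 a) t = \<alpha> * (1 - of_real t))"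
  proof -
    obtain \<beta> where "cmod \<beta> = 1" and
     "(\<forall>t\<in>{0..1}. V (c1_affine 0 a) t = (\<beta> * a) * of_real t) \<or>
      (\<forall>t\<in>{0..1}. V (c1_affine 0 a) t = (\<beta> * a) * (1 - of_real t)) \<or>
      (\<forall>t\<in>{0..1}. V (c1_affine 0 a) t = (\<beta> * cnj a) * of_real t) \<or>
      (\<forall>t\<in>{0..1}. V (c1_affine 0 a) t = (\<beta> * cnj a) * (1 - of_real t))"
      using orbit_map_in_orbit[OF V, of "c1_affine 0 a"] unfolding in_orbit_alt
      by (auto simp: c1_fun_affine mult.assoc)
    then show ?thesis
      using that by blast
  qed
  \<comment> \<open>At t = 0 the preserved sum is \<alpha> in both cases, and it equals
    \<open>a\<close>.\<close>
  then have "\<alpha> = a"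
    using sum_reflect_preserved[of 0 "c1_affine 0 a"] by (auto simp: c1_fun_affine)
  with \<alpha> show ?thesis by simp
qed

lemma fixes_all_if_fixes_Id:
  assumes Id: "\<forall>t\<in>{0..1}. V (c1_affine 0 1) t = of_real t" and t: "t \<in> {0..1}"
  shows "V f t = c1_fun f t"
proof -
  have iId: "\<forall>t\<in>{0..1}. V (c1_affine 0 \<i>) t = \<i> * of_real t"
  proof (rule ccontr)
    assume "\<not> ?thesis"
    then have *: "\<forall>t\<in>{0..1}. V (c1_affine 0 \<i>) t = \<i> * (1 - of_real t)"
      using linear_image[of \<i>] by auto
    \<comment> \<open>\<open>t - \<i> (1 - t)\<close> has modulus 1 at both end points, whereas \<open>t - \<i> t\<close> vanishes at 0\<close>
    have "in_orbit (\<lambda>t. c1_fun (c1_affine 0 1) t - c1_fun (c1_affine 0 \<i>) t)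
            (\<lambda>t. V (c1_affine 0 1) t - V (c1_affine 0 \<i>) t)"
      using V by (simp add: orbit_map_def)
    from in_orbit_zero[OF this] show False
      using Id * by (simp add: c1_fun_affine)
  qed
  show ?thesis
  \<comment> \<open>The plain and the weighted sum form a linear system for the values at t and 1 -
    t, singular only at t = 1/2; there the plain sum is twice the value.\<close>
  proof (cases "t = 1 - t")
    case True
    then show ?thesis
      using sum_reflect_preserved[OF t, of f] unfolding True[symmetric] by simp
  next
    case False
    have cancel: "x = y" if "x + x' = y + y'" "t * x + (1 - t) * x' = t * y + (1 - t) * y'"
      for x x' y y' :: real
    proof -
      \<comment> \<open>Subtracting 1 - t times the first equation from the second eliminates
        \<open>x'\<close> and \<open>y'\<close>.\<close>
      have "(t - (1 - t)) * (x - y) = (t * x + (1 - t) * x') - (1 - t) * (x + x')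
          - ((t * y + (1 - t) * y') - (1 - t) * (y + y'))"
        by (simp add: algebra_simps)
      then have "(t - (1 - t)) * (x - y) = 0"
        by (simp only: that diff_self)
      then show ?thesis
        using False by simp
    qed
    have t': "1 - t \<in> {0..1}"
      using t by simp
    show ?thesis
    proof (rule complex_eqI)
      have "Re (V f t) + Re (V f (1 - t)) = Re (c1_fun f t) + Re (c1_fun f (1 - t))"
        using arg_cong[OF sum_reflect_preserved[OF t, of f], of Re] by simp
      moreover have "t * Re (V f t) + (1 - t) * Re (V f (1 - t))
          = t * Re (c1_fun f t) + (1 - t) * Re (c1_fun f (1 - t))"
        using orbit_map_inner[OF V t, of f "c1_affine 0 1"] bspec[OF Id t] bspec[OF Id t']
          c1_fun_affine[OF t, of 0 1] c1_fun_affine[OF t', of 0 1]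
        by (simp add: inner_complex_def mult.commute)
      ultimately show "Re (V f t) = Re (c1_fun f t)"
        by (rule cancel)
    next
      have "Im (V f t) + Im (V f (1 - t)) = Im (c1_fun f t) + Im (c1_fun f (1 - t))"
        using arg_cong[OF sum_reflect_preserved[OF t, of f], of Im] by simp
      moreover have "t * Im (V f t) + (1 - t) * Im (V f (1 - t))
          = t * Im (c1_fun f t) + (1 - t) * Im (c1_fun f (1 - t))"
        using orbit_map_inner[OF V t, of f "c1_affine 0 \<i>"] bspec[OF iId t] bspec[OF iId t']
          c1_fun_affine[OF t, of 0 "\<i>"] c1_fun_affine[OF t', of 0 "\<i>"]
        by (simp add: inner_complex_def mult.commute)
      ultimately show "Im (V f t) = Im (c1_fun f t)"
        by (rule cancel)
    qed
  qed
qed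

end

section \<open>Undoing the normalisation\<close>

text \<open>If \<open>Id\<close> goes to 1 - \<open>Id\<close>, composing with the reflection
  restores \<open>Id\<close> and still fixes 1 and \<i>.\<close>

lemma orbit_map_fixing_constants:
  assumes V: "orbit_map V"
    and V1: "\<And>t. t \<in> {0..1} \<Longrightarrow> V (c1_affine 1 0) t = 1"
    and Vi: "\<And>t. t \<in> {0..1} \<Longrightarrow> V (c1_affine \<i> 0) t = \<i>"
  shows "\<exists>\<pi>\<in>{\<lambda>t. t, \<lambda>t. 1 - t}. \<forall>f. \<forall>t\<in>{0..1}. V f t = c1_fun f (\<pi> t)"
proof -
  have "(\<forall>t\<in>{0..1}. V (c1_affine 0 1) t = of_real t) \<or>
        (\<forall>t\<in>{0..1}. V (c1_affine 0 1) t = 1 - of_real t)"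
    using linear_image[OF assms, of 1] by simp
  then show ?thesis
  proof
    assume "\<forall>t\<in>{0..1}. V (c1_affine 0 1) t = of_real t"
    then show ?thesis
      using fixes_all_if_fixes_Id[OF assms] by simp
  next
    assume *: "\<forall>t\<in>{0..1}. V (c1_affine 0 1) t = 1 - of_real t"
    have reflected: "V f (1 - t) = c1_fun f t" if "t \<in> {0..1}" for f t
    proof (rule fixes_all_if_fixes_Id[OF orbit_map_reflect[OF V] _ _ _ that])
      show "\<forall>t\<in>{0..1}. V (c1_affine 0 1) (1 - t) = of_real t"
        using * by simp
    qed (use V1 Vi in simp_all)
    have "V f t = c1_fun f (1 - t)" if "t \<in> {0..1}" for f t
      using reflected[of "1 - t" f] that by simp
    then show ?thesis
      by simp
  qed
qed

lemma orbit_map_form: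
  assumes V: "orbit_map V"
  shows "\<exists>\<alpha> \<pi> \<epsilon>. cmod \<alpha> = 1 \<and> \<pi> \<in> {\<lambda>t. t, \<lambda>t. 1 - t} \<and> \<epsilon> \<in> {1, -1} \<and>
    (\<forall>f. \<forall>t\<in>{0..1}. V f t = \<alpha> * conj_pow (c1_fun f \<circ> \<pi>) \<epsilon> t)"
proof -
  obtain a where a: "cmod a = 1" and Va: "\<And>t. t \<in> {0..1} \<Longrightarrow> V (c1_affine 1 0) t = a"
    using orbit_map_const[OF V, of 1] by auto
  \<comment> \<open>Rotating back by \<open>cnj a\<close> makes the image of 1 equal to 1.\<close>
  define W where "W = (\<lambda>f t. cnj a * V f t)"
  have aa: "a * cnj a = 1" "cnj a * a = 1"
    using complex_norm_square[of a] a by (simp_all add: mult.commute)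
  have VW: "V f t = a * W f t" for f t
    by (simp add: W_def mult.assoc[symmetric] aa)
  have W: "orbit_map W"
    unfolding W_def using V a by (intro orbit_map_scale) auto
  have W1: "W (c1_affine 1 0) t = 1" if "t \<in> {0..1}" for t
    using that by (simp add: W_def Va aa)
  obtain b where b: "cmod b = 1" and Wb: "\<And>t. t \<in> {0..1} \<Longrightarrow> W (c1_affine \<i> 0) t = b"
    using orbit_map_const[OF W, of \<i>] by auto
  \<comment> \<open>The constants 1 and \<i> are orthogonal for the preserved form, hence so are
    their images 1 and \<open>b\<close>.\<close>
  have "Re b = 0"
    using orbit_map_inner[OF W, of 0 "c1_affine \<i> 0" "c1_affine 1 0"]
    by (simp add: c1_fun_affine inner_complex_def W1 Wb)
  moreover have "\<bar>Im b\<bar> = 1"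
    using b \<open>Re b = 0\<close> by (simp add: cmod_def)
  ultimately have "b = \<i> \<or> b = - \<i>"
    by (auto simp: complex_eq_iff abs_if split: if_splits)
  then show ?thesis
  proof
    assume "b = \<i>"
    then have "\<exists>\<pi>\<in>{\<lambda>t. t, \<lambda>t. 1 - t}. \<forall>f. \<forall>t\<in>{0..1}. W f t = c1_fun f (\<pi> t)"
      using Wb by (intro orbit_map_fixing_constants W W1) simp_all
    then obtain \<pi> where \<pi>: "\<pi> \<in> {\<lambda>t. t, \<lambda>t. 1 - t}"
      and "\<forall>f. \<forall>t\<in>{0..1}. W f t = c1_fun f (\<pi> t)" ..
    then have "\<forall>f. \<forall>t\<in>{0..1}. V f t = a * conj_pow (c1_fun f \<circ> \<pi>) 1 t"
      by (simp add: VW conj_pow_def)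
    with a \<pi> show ?thesis by blast
  next
    \<comment> \<open>Here conjugating \<open>W\<close> sends -\<i> to \<i> and keeps 1.\<close>
    assume "b = - \<i>"
    then have "\<exists>\<pi>\<in>{\<lambda>t. t, \<lambda>t. 1 - t}. \<forall>f. \<forall>t\<in>{0..1}. cnj (W f t) = c1_fun f (\<pi> t)"
      using W1 Wb by (intro orbit_map_fixing_constants orbit_map_cnj W) simp_all
    then obtain \<pi> where \<pi>: "\<pi> \<in> {\<lambda>t. t, \<lambda>t. 1 - t}"
      and "\<forall>f. \<forall>t\<in>{0..1}. cnj (W f t) = c1_fun f (\<pi> t)" ..
    then have "\<forall>f. \<forall>t\<in>{0..1}. W f t = cnj (c1_fun f (\<pi> t))"
      by (metis complex_cnj_cnj)
    then have "\<forall>f. \<forall>t\<in>{0..1}. V f t = a * conj_pow (c1_fun f \<circ> \<pi>) (- 1) t"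
      by (simp add: VW conj_pow_def)
    with a \<pi> show ?thesis by blast
  qed
qed

theorem corollary15:
  fixes N1 N2 :: "c1 \<Rightarrow> real" and T :: "c1 \<Rightarrow> c1"
  assumes "is_c1_norm N1" and "is_c1_norm N2"
    and "Iso N1 N2 =
      {S. \<exists>(\<beta> :: c1) (\<alpha> :: complex) (\<pi> :: real \<Rightarrow> real) (\<epsilon> :: int).
            cmod \<alpha> = 1 \<and> \<pi> \<in> {\<lambda>t. t, \<lambda>t. 1 - t} \<and> \<epsilon> \<in> {1, -1} \<and>
            (\<forall>f. \<forall>t\<in>{0..1}.
               c1_fun (S f) t = c1_fun \<beta> t + \<alpha> * conj_pow (c1_fun f \<circ> \<pi>) \<epsilon> t)}"
    and "two_local (Iso N1 N2) T"
  shows "T \<in> Iso N1 N2"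
proof -
  define V where "V = (\<lambda>f t. c1_fun (T f) t - c1_fun (T 0) t)"
  have "in_orbit (\<lambda>t. c1_fun f t - c1_fun g t) (\<lambda>t. V f t - V g t)" for f g
  proof -
    obtain S where "S \<in> Iso N1 N2" and S: "T f = S f" "T g = S g"
      using assms(4) unfolding two_local_def by blast
    then obtain \<beta> :: c1 and \<alpha> \<pi> and \<epsilon> :: int where
      *: "cmod \<alpha> = 1" "\<pi> \<in> {\<lambda>t. t, \<lambda>t. 1 - t}" "\<epsilon> \<in> {1, -1}"
      and "\<forall>h. \<forall>t\<in>{0..1}. c1_fun (S h) t = c1_fun \<beta> t + \<alpha> * conj_pow (c1_fun h \<circ> \<pi>) \<epsilon> t"
      unfolding assms(3) mem_Collect_eq by (elim exE conjE)
    \<comment> \<open>The translation \<beta> cancels in the difference; \<alpha>, \<pi> and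
      \<epsilon> may still depend on \<open>f\<close> and \<open>g\<close>.\<close>
    then have "V f t - V g t = \<alpha> * conj_pow ((\<lambda>t. c1_fun f t - c1_fun g t) \<circ> \<pi>) \<epsilon> t"
      if "t \<in> {0..1}" for t
      using that by (simp add: V_def S conj_pow_def right_diff_distrib)
    with * show ?thesis
      unfolding in_orbit_def by (intro exI conjI ballI)
  qed
  then have "orbit_map V"
    by (simp add: orbit_map_def V_def)
  from orbit_map_form[OF this] obtain \<alpha> \<pi> \<epsilon> where
    *: "cmod \<alpha> = 1" "\<pi> \<in> {\<lambda>t. t, \<lambda>t. 1 - t}" "\<epsilon> \<in> {1, -1}"
    and "\<forall>f. \<forall>t\<in>{0..1}. V f t = \<alpha> * conj_pow (c1_fun f \<circ> \<pi>) \<epsilon> t"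
    by (elim exE conjE)
  \<comment> \<open>Now \<alpha>, \<pi> and \<epsilon> are the same for all \<open>f\<close>, and
    \<open>T 0\<close> serves as \<beta>.\<close>
  then have "c1_fun (T f) t = c1_fun (T 0) t + \<alpha> * conj_pow (c1_fun f \<circ> \<pi>) \<epsilon> t"
    if "t \<in> {0..1}" for f t
    using that unfolding V_def diff_eq_eq add.commute[of "c1_fun (T 0) t"] by blast
  with * show ?thesis
    unfolding assms(3) mem_Collect_eq by (intro exI conjI allI ballI)
qed

end
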